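(* Let $\eta=(\eta_k)_{k\ge 1}$ be a sequence of real numbers and let $0\le r<\infty$. Then $\|\eta\|_D\le r$ if and only if there exist non-decreasing real sequences $\chi_1=(\chi_1(k))_{k\ge 0}$ and $\chi_2=(\chi_2(k))_{k\ge 0}$ such that $\|\chi_2-\chi_1\|_\infty\le r/2$ and $$\eta_k=(\chi_2(k)-\chi_2(k-1))-(\chi_1(k)-\chi_1(k-1))\qquad\text{for all } k\ge 1.$$
   Context: For a real sequence $\eta=(\eta_k)_{k\ge1}$ the discrepancy norm is $\|\eta\|_D:=\sup_{1\le n_1\le n_2}\left|\sum_{i=n_1}^{n_2}\eta_i\right|\in[0,\infty]$. For a sequence $\chi=(\chi(k))_{k\ge0}$, $\|\chi\|_\infty=\sup_{k\ge0}|\chi(k)|$. *)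

theory Defs
  imports Complex_Main "HOL-Library.Extended_Real"
begin

text \<open>
  A sequence indexed by $k \ge 1$ is represented as a function on all of \<^typ>\<open>nat\<close>;
  its value at \<open>0\<close> is never used.
  Both norms may be infinite, so they are taken in \<^typ>\<open>ereal\<close>.
\<close>

definition discrepancy_norm :: "(nat \<Rightarrow> real) \<Rightarrow> ereal" where
  "discrepancy_norm \<eta> =
     (SUP (n1, n2) \<in> {(n1, n2). 1 \<le> n1 \<and> n1 \<le> n2}. ereal \<bar>\<Sum>i=n1..n2. \<eta> i\<bar>)"

definition seq_sup_norm :: "(nat \<Rightarrow> real) \<Rightarrow> ereal" where
  "seq_sup_norm \<chi> = (SUP k. ereal \<bar>\<chi> k\<bar>)"

end

theory Submission
  imports Defs
begin

text \<open>
  Both conditions say that the partial sums of \<open>\<eta>\<close> have oscillation at most \<open>r\<close>. Equivalently, some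
  translate of the partial sums lies in \<open>[-r/2, r/2]\<close>, and this translate is split into its
  positive and negative variation.
\<close>

lemma discrepancy_norm_le_iff:
  "discrepancy_norm \<eta> \<le> ereal r \<longleftrightarrow>
     (\<forall>n1 n2. 1 \<le> n1 \<longrightarrow> n1 \<le> n2 \<longrightarrow> \<bar>\<Sum>i=n1..n2. \<eta> i\<bar> \<le> r)"
  unfolding discrepancy_norm_def by (auto simp: SUP_le_iff)

lemma seq_sup_norm_le_iff: "seq_sup_norm \<chi> \<le> ereal r \<longleftrightarrow> (\<forall>k. \<bar>\<chi> k\<bar> \<le> r)"
  unfolding seq_sup_norm_def by (simp add: SUP_le_iff)

lemma sum_eq_diff_of_increments:
  fixes D \<eta> :: "nat \<Rightarrow> real"
  assumes "\<And>k. 1 \<le> k \<Longrightarrow> \<eta> k = D k - D (k - 1)" and "1 \<le> m" and "m \<le> n"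
  shows "(\<Sum>i=m..n. \<eta> i) = D n - D (m - 1)"
proof -
  have "(\<Sum>i=m..n. \<eta> i) = (\<Sum>i=m..n. D i - D (i - 1))"
    using assms by (intro sum.cong) auto
  also have "\<dots> = D n - D (m - 1)"
    using sum_telescope''[of "m - 1" n D] assms(2,3)
    by (cases m) (simp_all add: atLeastSucAtMost_greaterThanAtMost)
  finally show ?thesis .
qed

text \<open>A block sum over \<open>n1..n2\<close> telescopes to \<open>D n2 - D (n1 - 1)\<close>,
  and the pairs \<open>(n1 - 1, n2)\<close> with \<open>1 \<le> n1 \<le> n2\<close> are exactly the
  pairs \<open>i < j\<close>. Symmetry gives \<open>i > j\<close>, and \<open>0 \<le> r\<close>
  settles \<open>i = j\<close>. \<open>D\<close> may be any sequence with increments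
  \<open>\<eta>\<close>, so that both the partial sums and \<open>\<chi>2 - \<chi>1\<close>
  qualify.\<close>

lemma discrepancy_norm_le_iff_oscillation:
  fixes D \<eta> :: "nat \<Rightarrow> real"
  assumes "\<And>k. 1 \<le> k \<Longrightarrow> \<eta> k = D k - D (k - 1)" and "0 \<le> r"
  shows "discrepancy_norm \<eta> \<le> ereal r \<longleftrightarrow> (\<forall>m n. \<bar>D m - D n\<bar> \<le> r)"
proof -
  note sum = sum_eq_diff_of_increments[of \<eta> D, OF assms(1)]
  show ?thesis
    unfolding discrepancy_norm_le_iff
  proof safe
    fix m n
    assume le: "\<forall>n1 n2. 1 \<le> n1 \<longrightarrow> n1 \<le> n2 \<longrightarrow> \<bar>\<Sum>i=n1..n2. \<eta> i\<bar> \<le> r"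
    have less: "\<bar>D j - D i\<bar> \<le> r" if "i < j" for i j
      using le[rule_format, of "Suc i" j] sum[of "Suc i" j] that by simp
    show "\<bar>D m - D n\<bar> \<le> r"
      using less[of m n] less[of n m] \<open>0 \<le> r\<close>
      by (cases m n rule: linorder_cases) (simp_all add: abs_minus_commute)
  next
    fix n1 n2 :: nat
    assume "\<forall>m n. \<bar>D m - D n\<bar> \<le> r" "1 \<le> n1" "n1 \<le> n2"
    then show "\<bar>\<Sum>i=n1..n2. \<eta> i\<bar> \<le> r"
      by (metis sum)
  qed
qed

text \<open>A set of reals of diameter at most \<open>r\<close> lies in the interval of length
  \<open>r\<close> that ends at its supremum; the midpoint serves as \<open>c\<close>. The converse
  is the triangle inequality through \<open>c\<close>.\<close>

lemma oscillation_le_iff_centred: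
  fixes D :: "'a \<Rightarrow> real"
  shows "(\<forall>x y. \<bar>D x - D y\<bar> \<le> r) \<longleftrightarrow> (\<exists>c. \<forall>x. \<bar>D x - c\<bar> \<le> r / 2)"
proof
  assume osc: "\<forall>x y. \<bar>D x - D y\<bar> \<le> r"
  have upper: "D x \<le> D y + r" for x y
    using osc[rule_format, of x y] by linarith
  \<comment> \<open>Any one value of \<open>D\<close> bounds all the others up to \<open>r\<close>;
    \<open>undefined\<close> is merely some point of the domain type.\<close>
  then have "bdd_above (range D)"
    by (intro bdd_aboveI2[where M = "D undefined + r"])
  then have Sup_upper: "D x \<le> Sup (range D)" for x
    by (intro cSUP_upper) auto
  have Sup_least: "Sup (range D) \<le> D x + r" for x
    using upper by (intro cSUP_least) auto
  have "\<bar>D x - (Sup (range D) - r / 2)\<bar> \<le> r / 2" for x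
    using Sup_upper[of x] Sup_least[of x] unfolding abs_le_iff by linarith
  then show "\<exists>c. \<forall>x. \<bar>D x - c\<bar> \<le> r / 2"
    by blast
next
  assume "\<exists>c. \<forall>x. \<bar>D x - c\<bar> \<le> r / 2"
  then obtain c where c: "\<And>x. \<bar>D x - c\<bar> \<le> r / 2"
    by blast
  show "\<forall>x y. \<bar>D x - D y\<bar> \<le> r"
  proof (intro allI)
    fix x y
    show "\<bar>D x - D y\<bar> \<le> r"
      using c[of x] c[of y] by linarith
  qed
qed

theorem theorem3p3:
  fixes \<eta> :: "nat \<Rightarrow> real" and r :: real
  assumes "0 \<le> r"
  shows "discrepancy_norm \<eta> \<le> ereal r \<longleftrightarrow>
    (\<exists>\<chi>1 \<chi>2 :: nat \<Rightarrow> real. mono \<chi>1 \<and> mono \<chi>2 \<and>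
       seq_sup_norm (\<lambda>k. \<chi>2 k - \<chi>1 k) \<le> ereal (r / 2) \<and>
       (\<forall>k\<ge>1. \<eta> k = (\<chi>2 k - \<chi>2 (k - 1)) - (\<chi>1 k - \<chi>1 (k - 1))))"
    (is "_ \<longleftrightarrow> ?rhs")
proof
  \<comment> \<open>The empty sum \<open>S 0 = 0\<close> makes the increment formula valid from
    \<open>k = 1\<close> on.\<close>
  define S where "S k = (\<Sum>i=1..k. \<eta> i)" for k
  have S: "\<eta> k = S k - S (k - 1)" if "1 \<le> k" for k
    using that by (cases k) (simp_all add: S_def)
  assume "discrepancy_norm \<eta> \<le> ereal r"
  then obtain c where c: "\<And>k. \<bar>S k - c\<bar> \<le> r / 2"
    using discrepancy_norm_le_iff_oscillation[of \<eta> S r, OF S assms] oscillation_le_iff_centred[of S r]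
    by blast
  \<comment> \<open>Jordan decomposition: \<open>\<chi>1\<close> accumulates the negative parts of
    \<open>\<eta>\<close> and \<open>\<chi>2\<close> the positive parts. The constant
    \<open>- c\<close> changes neither monotonicity nor increments, but it centres
    \<open>\<chi>2 - \<chi>1\<close>.\<close>
  define \<chi>1 where "\<chi>1 k = (\<Sum>i=1..k. max 0 (- \<eta> i))" for k
  define \<chi>2 where "\<chi>2 k = (\<Sum>i=1..k. max 0 (\<eta> i)) - c" for k
  have diff: "\<chi>2 k - \<chi>1 k = S k - c" for k
  proof -
    \<comment> \<open>Termwise, a real number is its positive part minus its negative part.\<close>
    have "(\<Sum>i=1..k. max 0 (\<eta> i)) - (\<Sum>i=1..k. max 0 (- \<eta> i)) = S k"
      unfolding S_def sum_subtractf[symmetric] by (intro sum.cong) auto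
    then show ?thesis
      by (simp add: \<chi>1_def \<chi>2_def)
  qed
  have "mono \<chi>1" "mono \<chi>2"
    by (simp_all add: mono_iff_le_Suc \<chi>1_def \<chi>2_def)
  moreover have "seq_sup_norm (\<lambda>k. \<chi>2 k - \<chi>1 k) \<le> ereal (r / 2)"
    using c by (simp add: seq_sup_norm_le_iff diff)
  moreover have "\<eta> k = (\<chi>2 k - \<chi>2 (k - 1)) - (\<chi>1 k - \<chi>1 (k - 1))" if "1 \<le> k" for k
    using S[OF that] diff[of k] diff[of "k - 1"] by linarith
  ultimately show ?rhs
    by blast
next
  assume ?rhs
  then obtain \<chi>1 \<chi>2 :: "nat \<Rightarrow> real"
    where bound: "\<And>k. \<bar>\<chi>2 k - \<chi>1 k\<bar> \<le> r / 2"
      and \<eta>: "\<And>k. 1 \<le> k \<Longrightarrow> \<eta> k = (\<chi>2 k - \<chi>2 (k - 1)) - (\<chi>1 k - \<chi>1 (k - 1))"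
    by (auto simp: seq_sup_norm_le_iff)
  define D where "D k = \<chi>2 k - \<chi>1 k" for k
  have "\<eta> k = D k - D (k - 1)" if "1 \<le> k" for k
    using \<eta>[OF that] by (simp add: D_def)
  \<comment> \<open>Written with \<open>- 0\<close> to exhibit \<open>0\<close> as the centre in the
    oscillation criterion.\<close>
  moreover have "\<forall>k. \<bar>D k - 0\<bar> \<le> r / 2"
    using bound by (simp add: D_def)
  then have "\<forall>m n. \<bar>D m - D n\<bar> \<le> r"
    using oscillation_le_iff_centred[of D r] by blast
  ultimately show "discrepancy_norm \<eta> \<le> ereal r"
    using discrepancy_norm_le_iff_oscillation[of \<eta> D r] assms by blast
qed

end
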